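(* Let $c\neq 0$ and $\lambda>0$ be real constants, let $I\subset\mathbb{R}$ be an open interval on which $\cos\left(\frac{u}{c}\right)\neq0$ and $1-\frac{\lambda^2}{c^2}\sin^2\left(\frac{u}{c}\right)>0$, and let $\rho=\rho(v)$ be a smooth curve parametrized by arclength on the unit sphere $S^2$ of the subspace $\mathbb{E}^3=\mathrm{span}\{e_2,e_3,e_4\}$ of $\mathbb{E}^4$. Then the generalized spherical surface of second kind determined by $c,\lambda,\rho$ is a meridian surface $X(u,v)=f_1(u)e_1+f_2(u)\rho(v)$ with $$f_1(u)=\int\sqrt{1-\frac{\lambda^2}{c^2}\sin^2\left(\frac uc\right)}\,du,\qquad f_2(u)=\lambda\cos\left(\frac uc\right).$$
   Context: Let $e_1,\dots,e_4$ be the standard orthonormal basis of $\mathbb{E}^4$. The generalized spherical surface of second kind determined by $c,\lambda,\rho$ is the surface in $\mathbb{E}^4$ given by $$X(u,v)=\phi(u)\,e_1+\lambda\cos\left(\tfrac uc\right)\rho(v),\qquad \phi(u)=\int\sqrt{1-\tfrac{\lambda^2}{c^2}\sin^2\left(\tfrac uc\right)}\,du,\qquad u\in I$$ (any antiderivative). A meridian surface in $\mathbb{E}^4$ (in the sense of Ganchev and Milousheva: a one-parameter system of meridians of a rotational hypersurface with axis $e_1$) is a surface of the form $X(u,v)=f_1(u)e_1+f_2(u)\rho(v)$, where $\rho$ is a smooth unit-speed curve on the unit sphere $S^2\subset\mathrm{span}\{e_2,e_3,e_4\}$ and $f_1,f_2$ are smooth functions with $(f_1')^2+(f_2')^2=1$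 and $f_2\neq0$. *)

theory Defs
  imports "HOL-Analysis.Analysis"
begin

text \<open>
  $C^\infty$ for maps of one real variable, via iterated derivatives. The derivatives are two-sided,
  so this is meant for open \<open>S\<close>; there it depends only on the values of \<open>f\<close> on \<open>S\<close>.
\<close>

definition smooth_curve_on :: "real set \<Rightarrow> (real \<Rightarrow> 'a::real_normed_vector) \<Rightarrow> bool" where
  "smooth_curve_on S f \<longleftrightarrow>
     (\<forall>n. \<forall>t\<in>S. ((\<lambda>g t. vector_derivative g (at t)) ^^ n) f differentiable (at t))"

definition unit_speed_spherical_curve :: "real set \<Rightarrow> (real \<Rightarrow> real^4) \<Rightarrow> bool" where
  "unit_speed_spherical_curve J \<rho> \<longleftrightarrow>
     smooth_curve_on J \<rho> \<and>
     (\<forall>v\<in>J. \<rho> v \<in> span {axis 2 1, axis 3 1, axis 4 1} \<and> norm (\<rho> v) = 1 \<and>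
            norm (vector_derivative \<rho> (at v)) = 1)"

text \<open>
  Surfaces are parametrized maps \<open>X u v\<close>, of which only the values on \<open>I \<times> J\<close> matter. The
  indefinite integral \<open>\<phi>\<close> is an arbitrary antiderivative on \<open>I\<close>.
\<close>

definition generalized_spherical_surface_2 ::
  "real set \<Rightarrow> real set \<Rightarrow> real \<Rightarrow> real \<Rightarrow> (real \<Rightarrow> real^4) \<Rightarrow> (real \<Rightarrow> real \<Rightarrow> real^4) \<Rightarrow> bool" where
  "generalized_spherical_surface_2 I J c lam \<rho> X \<longleftrightarrow>
     (\<exists>\<phi>. (\<forall>u\<in>I. (\<phi> has_real_derivative sqrt (1 - lam\<^sup>2 / c\<^sup>2 * (sin (u / c))\<^sup>2)) (at u)) \<and>
          (\<forall>u\<in>I. \<forall>v\<in>J. X u v = \<phi> u *\<^sub>R axis 1 1 + (lam * cos (u / c)) *\<^sub>R \<rho> v))"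

definition meridian_surface ::
  "real set \<Rightarrow> real set \<Rightarrow> (real \<Rightarrow> real) \<Rightarrow> (real \<Rightarrow> real) \<Rightarrow> (real \<Rightarrow> real^4) \<Rightarrow>
     (real \<Rightarrow> real \<Rightarrow> real^4) \<Rightarrow> bool" where
  "meridian_surface I J f1 f2 \<rho> X \<longleftrightarrow>
     unit_speed_spherical_curve J \<rho> \<and>
     smooth_curve_on I f1 \<and> smooth_curve_on I f2 \<and>
     (\<forall>u\<in>I. (deriv f1 u)\<^sup>2 + (deriv f2 u)\<^sup>2 = 1 \<and> f2 u \<noteq> 0) \<and>
     (\<forall>u\<in>I. \<forall>v\<in>J. X u v = f1 u *\<^sub>R axis 1 1 + f2 u *\<^sub>R \<rho> v)"

end

theory Submission
  imports Defs
begin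

text \<open>
  With $f_1 = \phi$ the antiderivative that comes with the surface and
  $f_2(u) = \lambda\cos(u/c)$, the parametrization already has the form required of a meridian
  surface. The profile curve is unit-speed because
  $f_2'(u)^2 = \frac{\lambda^2}{c^2}\sin^2(u/c)$ is exactly what is subtracted under the root in
  $f_1'(u)$, and $f_2 \<noteq> 0$ because $\lambda > 0$ and
  $\cos(u/c) \<noteq> 0$ on $I$.

  The remaining point is that $f_1$ and $f_2$ are $C^\infty$. Let $r$ be the square root in question,
  which is positive on $I$. Differentiating any of $\phi$, $\sin(u/c)$, $\cos(u/c)$, $r$, $1/r$
  gives a polynomial in these same functions, so the algebra they generate is closed under
  differentiation. A family of functions closed under differentiation consists of smooth
  functions (\<open>smooth_curve_on_of_derivative_closed\<close>, \<open>generated_algebra_smooth\<close>).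
\<close>

text \<open>
  Closure under differentiation is a coinductive description of smoothness: each iterated
  derivative of \<open>f\<close> agrees on \<open>S\<close> with some member of \<open>F\<close>, which is differentiable there. Openness of \<open>S\<close> lets the derivatives, which are known
  on \<open>S\<close> only, be differentiated again.
\<close>

lemma smooth_curve_on_of_derivative_closed:
  fixes F :: "(real \<Rightarrow> 'a::real_normed_vector) set"
  assumes "open S" "f \<in> F"
    and closed: "\<And>g. g \<in> F \<Longrightarrow> \<exists>h\<in>F. \<forall>t\<in>S. (g has_vector_derivative h t) (at t)"
  shows "smooth_curve_on S f"
proof -
  let ?D = "\<lambda>g t. vector_derivative g (at t)"
  have transfer: "(k has_vector_derivative h t) (at t)"
    if "\<forall>t\<in>S. (g has_vector_derivative h t) (at t)" "\<forall>t\<in>S. k t = g t" "t \<in> S"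
    for g h k :: "real \<Rightarrow> 'a" and t
    using that has_vector_derivative_transform_within_open[OF _ \<open>open S\<close>, of g "h t" t k] by auto
  have iterate: "\<exists>g\<in>F. \<forall>t\<in>S. (?D ^^ n) f t = g t" for n
  proof (induction n)
    case 0
    show ?case using \<open>f \<in> F\<close> by auto
  next
    case (Suc n)
    then obtain g where g: "g \<in> F" "\<forall>t\<in>S. (?D ^^ n) f t = g t" by blast
    obtain h where h: "h \<in> F" "\<forall>t\<in>S. (g has_vector_derivative h t) (at t)"
      using closed[OF g(1)] by blast
    have "\<forall>t\<in>S. (?D ^^ Suc n) f t = h t"
      using transfer[OF h(2) g(2)] by (simp add: vector_derivative_at)
    then show ?case using h(1) by blast
  qed
  show ?thesis
    unfolding smooth_curve_on_def
  proof (intro allI ballI)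
    fix n t assume "t \<in> S"
    obtain g where g: "g \<in> F" "\<forall>t\<in>S. (?D ^^ n) f t = g t" using iterate by blast
    obtain h where "\<forall>t\<in>S. (g has_vector_derivative h t) (at t)"
      using closed[OF g(1)] by blast
    then show "(?D ^^ n) f differentiable (at t)"
      using transfer[OF _ g(2) \<open>t \<in> S\<close>] differentiableI_vector by blast
  qed
qed

inductive_set generated_algebra :: "(real \<Rightarrow> real) set \<Rightarrow> (real \<Rightarrow> real) set"
  for G :: "(real \<Rightarrow> real) set" where
  generator: "g \<in> G \<Longrightarrow> g \<in> generated_algebra G"
| const: "(\<lambda>_. a) \<in> generated_algebra G"
| add: "\<lbrakk>f \<in> generated_algebra G; g \<in> generated_algebra G\<rbrakk>
    \<Longrightarrow> (\<lambda>t. f t + g t) \<in> generated_algebra G"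
| mult: "\<lbrakk>f \<in> generated_algebra G; g \<in> generated_algebra G\<rbrakk>
    \<Longrightarrow> (\<lambda>t. f t * g t) \<in> generated_algebra G"

text \<open>
  By the sum and product rules, differentiability into the algebra only has to be checked on the
  generators.
\<close>

lemma generated_algebra_smooth:
  assumes "open S"
    and gen: "\<And>g. g \<in> G \<Longrightarrow>
      \<exists>h\<in>generated_algebra G. \<forall>t\<in>S. (g has_real_derivative h t) (at t)"
    and "f \<in> generated_algebra G"
  shows "smooth_curve_on S f"
proof (rule smooth_curve_on_of_derivative_closed[OF \<open>open S\<close> \<open>f \<in> generated_algebra G\<close>])
  fix g assume "g \<in> generated_algebra G"
  then have "\<exists>h\<in>generated_algebra G. \<forall>t\<in>S. (g has_real_derivative h t) (at t)"
  proof (induction rule: generated_algebra.induct)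
    case (generator g)
    then show ?case by (rule gen)
  next
    case (const a)
    show ?case by (rule bexI[OF _ generated_algebra.const[of 0]]) auto
  next
    case (add f g)
    then obtain f' g' where
      "f' \<in> generated_algebra G" "\<forall>t\<in>S. (f has_real_derivative f' t) (at t)"
      "g' \<in> generated_algebra G" "\<forall>t\<in>S. (g has_real_derivative g' t) (at t)" by blast
    then show ?case
      by (intro bexI[of _ "\<lambda>t. f' t + g' t"])
        (auto intro: generated_algebra.add DERIV_add)
  next
    case (mult f g)
    then obtain f' g' where
      "f' \<in> generated_algebra G" "\<forall>t\<in>S. (f has_real_derivative f' t) (at t)"
      "g' \<in> generated_algebra G" "\<forall>t\<in>S. (g has_real_derivative g' t) (at t)" by blast
    with mult.hyps show ?case
      by (intro bexI[of _ "\<lambda>t. f' t * g t + g' t * f t"])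
        (auto intro: generated_algebra.add generated_algebra.mult DERIV_mult)
  qed
  then show "\<exists>h\<in>generated_algebra G. \<forall>t\<in>S. (g has_vector_derivative h t) (at t)"
    by (simp add: has_real_derivative_iff_has_vector_derivative)
qed

text \<open>
  With $r = \sqrt{1 - k \sin^2(u/c)}$, the function $1/r$ has to be a generator as well, since
  $r' = -\frac{k}{c} \sin(u/c) \cos(u/c) \cdot \frac1r$; after that
  $(1/r)' = -r' \cdot \frac1r \cdot \frac1r$ leads to nothing new.
\<close>

lemma smooth_elliptic_antiderivative_and_cos:
  fixes c k a :: real
  assumes "c \<noteq> 0" "open S"
    and pos: "\<And>u. u \<in> S \<Longrightarrow> 1 - k * (sin (u / c))\<^sup>2 > 0"
    and \<phi>: "\<And>u. u \<in> S \<Longrightarrow>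
      (\<phi> has_real_derivative sqrt (1 - k * (sin (u / c))\<^sup>2)) (at u)"
  shows "smooth_curve_on S \<phi>" and "smooth_curve_on S (\<lambda>u. a * cos (u / c))"
proof -
  define r where "r = (\<lambda>u. sqrt (1 - k * (sin (u / c))\<^sup>2))"
  define s where "s = (\<lambda>u. sin (u / c))"
  define q where "q = (\<lambda>u. cos (u / c))"
  define ri where "ri = (\<lambda>u. inverse (r u))"
  define G where "G = {\<phi>, s, q, r, ri}"
  note alg = generated_algebra.intros
  have mem: "\<phi> \<in> generated_algebra G" "s \<in> generated_algebra G" "q \<in> generated_algebra G"
    "r \<in> generated_algebra G" "ri \<in> generated_algebra G"
    by (auto simp: G_def intro: generated_algebra.generator)
  have r_pos: "r u > 0" if "u \<in> S" for u
    using pos[OF that] by (simp add: r_def)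
  have dr: "(r has_real_derivative (- k / c) * (s u * (q u * ri u))) (at u)" if "u \<in> S" for u
    unfolding r_def s_def q_def ri_def using pos[OF that] \<open>c \<noteq> 0\<close>
    by (auto intro!: derivative_eq_intros simp: field_simps)
  have ds: "(s has_real_derivative (1 / c) * q u) (at u)" for u
    unfolding s_def q_def using \<open>c \<noteq> 0\<close> by (auto intro!: derivative_eq_intros)
  have dq: "(q has_real_derivative (- 1 / c) * s u) (at u)" for u
    unfolding s_def q_def using \<open>c \<noteq> 0\<close> by (auto intro!: derivative_eq_intros)
  have dri: "(ri has_real_derivative (k / c) * (s u * (q u * (ri u * (ri u * ri u))))) (at u)"
    if "u \<in> S" for u
  proof -
    have "r u \<noteq> 0" using r_pos[OF that] by simp
    from DERIV_inverse_fun[OF dr[OF that] this] show ?thesis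
      unfolding ri_def by (simp add: field_simps)
  qed
  have gen: "\<exists>h\<in>generated_algebra G. \<forall>t\<in>S. (g has_real_derivative h t) (at t)"
    if "g \<in> G" for g
  proof -
    from that consider "g = \<phi>" | "g = s" | "g = q" | "g = r" | "g = ri"
      unfolding G_def by blast
    then show ?thesis
    proof cases
      case 1
      have "\<forall>t\<in>S. (\<phi> has_real_derivative r t) (at t)" using \<phi> by (simp add: r_def)
      with 1 show ?thesis using mem by blast
    next
      case 2
      have "(\<lambda>u. (1 / c) * q u) \<in> generated_algebra G" by (intro alg(2,4) mem)
      then show ?thesis unfolding 2 by (rule bexI[rotated]) (use ds in blast)
    next
      case 3
      have "(\<lambda>u. (- 1 / c) * s u) \<in> generated_algebra G" by (intro alg(2,4) mem)
      then show ?thesis unfolding 3 by (rule bexI[rotated]) (use dq in blast)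
    next
      case 4
      have "(\<lambda>u. (- k / c) * (s u * (q u * ri u))) \<in> generated_algebra G"
        by (intro alg(2,4) mem)
      then show ?thesis unfolding 4 by (rule bexI[rotated]) (use dr in blast)
    next
      case 5
      have "(\<lambda>u. (k / c) * (s u * (q u * (ri u * (ri u * ri u))))) \<in> generated_algebra G"
        by (intro alg(2,4) mem)
      then show ?thesis unfolding 5 by (rule bexI[rotated]) (use dri in blast)
    qed
  qed
  show "smooth_curve_on S \<phi>"
    by (rule generated_algebra_smooth[OF \<open>open S\<close> gen mem(1)])
  have "(\<lambda>u. a * q u) \<in> generated_algebra G" by (intro alg(2,4) mem)
  from generated_algebra_smooth[OF \<open>open S\<close> gen this]
  show "smooth_curve_on S (\<lambda>u. a * cos (u / c))" by (simp add: q_def)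
qed

theorem corollary15:
  fixes c lam :: real and I J :: "real set"
    and \<rho> :: "real \<Rightarrow> real^4" and X :: "real \<Rightarrow> real \<Rightarrow> real^4"
  assumes "c \<noteq> 0" and "lam > 0"
    and "open I" and "is_interval I"
    and "\<And>u. u \<in> I \<Longrightarrow> cos (u / c) \<noteq> 0"
    and "\<And>u. u \<in> I \<Longrightarrow> 1 - lam\<^sup>2 / c\<^sup>2 * (sin (u / c))\<^sup>2 > 0"
    and "open J" and "is_interval J"
    and "unit_speed_spherical_curve J \<rho>"
    and "generalized_spherical_surface_2 I J c lam \<rho> X"
  shows "\<exists>f1 f2.
           (\<forall>u\<in>I. (f1 has_real_derivative sqrt (1 - lam\<^sup>2 / c\<^sup>2 * (sin (u / c))\<^sup>2)) (at u)) \<and>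
           (\<forall>u\<in>I. f2 u = lam * cos (u / c)) \<and>
           meridian_surface I J f1 f2 \<rho> X"
proof -
  obtain \<phi> where
    \<phi>: "\<And>u. u \<in> I \<Longrightarrow>
      (\<phi> has_real_derivative sqrt (1 - lam\<^sup>2 / c\<^sup>2 * (sin (u / c))\<^sup>2)) (at u)"
    and X: "\<forall>u\<in>I. \<forall>v\<in>J. X u v = \<phi> u *\<^sub>R axis 1 1 + (lam * cos (u / c)) *\<^sub>R \<rho> v"
    using assms(10) unfolding generalized_spherical_surface_2_def by blast
  let ?f2 = "\<lambda>u. lam * cos (u / c)"
  note smooth = smooth_elliptic_antiderivative_and_cos[OF assms(1,3,6) \<phi>]
  have unit_speed: "(deriv \<phi> u)\<^sup>2 + (deriv ?f2 u)\<^sup>2 = 1" if "u \<in> I" for u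
  proof -
    have "(?f2 has_real_derivative - (lam / c) * sin (u / c)) (at u)"
      using assms(1) by (auto intro!: derivative_eq_intros)
    then have "(deriv ?f2 u)\<^sup>2 = lam\<^sup>2 / c\<^sup>2 * (sin (u / c))\<^sup>2"
      by (simp add: DERIV_imp_deriv power_mult_distrib power_divide)
    moreover have "(deriv \<phi> u)\<^sup>2 = 1 - lam\<^sup>2 / c\<^sup>2 * (sin (u / c))\<^sup>2"
      using DERIV_imp_deriv[OF \<phi>[OF that]] assms(6)[OF that] by simp
    ultimately show ?thesis by simp
  qed
  have "meridian_surface I J \<phi> ?f2 \<rho> X"
    unfolding meridian_surface_def
    using assms(2,5,9) smooth unit_speed X by auto
  with \<phi> show ?thesis by (intro exI[of _ \<phi>] exI[of _ ?f2]) simp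
qed

end
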